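(* Let $n\ge 1$ be an integer and let $\alpha,\beta>0$ be real numbers which do not satisfy both inequalities $$\frac{n}{\alpha}+\frac{1}{\beta}\geq 1\quad\text{and}\quad \frac{1}{\alpha}+\frac{n}{\beta}\geq 1.$$ Then there is no finite constant $C$ such that $$\sup_{\Omega\in\mathcal K}\ \inf_{z\in\mathrm{int}\,\Omega}\Big(\int_{\mathbb S^n}r_z^\alpha \, d\sigma_{\mathbb S^n} \Big)^{\frac{1}{\alpha}}\Big(\int_{\mathbb S^n}(r_z^* )^\beta \, d\sigma_{\mathbb S^n}\Big)^{\frac{1}{\beta}}\leq C,$$ where, for $\Omega\in\mathcal K$ and $z\in\mathrm{int}\,\Omega$, $r_z=r_{\Omega,z}$ is the radial function of $\Omega$ with respect to $z$ and $r_z^*$ is the radial function with respect to $z$ of the dual body $\Omega_z^*$.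
   Context: $\mathcal K$ denotes the set of convex bodies in $\mathbb R^{n+1}$, i.e. compact convex subsets of $\mathbb R^{n+1}$ with non-empty interior. $\mathbb S^n\subset\mathbb R^{n+1}$ is the unit sphere and $\sigma_{\mathbb S^n}$ is its standard measure. For $\Omega\in\mathcal K$ and $z\in\mathrm{int}\,\Omega$, the radial function of $\Omega$ with respect to the centre $z$ is $r_z=r_{\Omega,z}:\mathbb S^n\to\mathbb R$, $r_z(x)=\sup\{\lambda>0 : \lambda x+z\in\Omega\}$. The dual body of $\Omega$ with respect to $z$ is $$\Omega_z^*=\{y+z : y\in\mathbb R^{n+1},\ y\cdot(x-z)\le 1\text{ for all }x\in\Omega\},$$ and $r_z^*=r_{\Omega_z^*,z}$ is the radial function of $\Omega_z^*$ with respect to $z$. *)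

theory Defs
  imports "HOL-Analysis.Analysis"
begin

definition convex_bodies :: "'a::euclidean_space set set" where
  "convex_bodies = {K. compact K \<and> convex K \<and> interior K \<noteq> {}}"

definition radial_function :: "'a::euclidean_space set \<Rightarrow> 'a \<Rightarrow> 'a \<Rightarrow> real" where
  "radial_function K z x = Sup {t. t > 0 \<and> t *\<^sub>R x + z \<in> K}"

definition dual_body :: "'a::euclidean_space set \<Rightarrow> 'a \<Rightarrow> 'a set" where
  "dual_body K z = {y + z |y. \<forall>x\<in>K. y \<bullet> (x - z) \<le> 1}"

text \<open>The surface measure on the unit sphere, defined by polar coordinates: the measure of a Borel
  subset of the sphere is the dimension of the ambient space times the Lebesgue measure of the
  cone over it in the punctured unit ball. It is not normalised; its total mass is the surface
  area of the sphere.\<close>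

definition sphere_measure :: "'a::euclidean_space measure" where
  "sphere_measure = scale_measure (of_nat DIM('a))
     (distr (restrict_space lborel (ball 0 1 - {0})) (restrict_space borel (sphere 0 1))
        (\<lambda>x. x /\<^sub>R norm x))"

lemma space_sphere_measure: "space (sphere_measure :: 'a::euclidean_space measure) = sphere 0 1"
  by (simp add: sphere_measure_def space_restrict_space space_scale_measure)

lemma sets_sphere_measure:
  "sets (sphere_measure :: 'a::euclidean_space measure) = sets (restrict_space borel (sphere 0 1))"
  by (simp add: sphere_measure_def)

lemma emeasure_sphere_measure:
  fixes A :: "'a::euclidean_space set"
  assumes "A \<in> sets sphere_measure"
  shows "emeasure sphere_measure A =
    of_nat DIM('a) * emeasure lborel {x \<in> ball 0 1 - {0}. x /\<^sub>R norm x \<in> A}"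
proof -
  let ?B = "ball 0 1 - {0} :: 'a set"
  have "(\<lambda>x::'a. x /\<^sub>R norm x) \<in> restrict_space lborel ?B \<rightarrow>\<^sub>M restrict_space borel (sphere 0 1)"
    by (rule measurable_restrict_space2)
      (auto simp: space_restrict_space intro!: measurable_restrict_space1)
  moreover have "(\<lambda>x. x /\<^sub>R norm x) -` A \<inter> ?B = {x \<in> ?B. x /\<^sub>R norm x \<in> A}"
    by auto
  moreover have "emeasure (restrict_space lborel ?B) {x \<in> ?B. x /\<^sub>R norm x \<in> A} =
      emeasure lborel {x \<in> ?B. x /\<^sub>R norm x \<in> A}"
    by (rule emeasure_restrict_space) auto
  ultimately show ?thesis
    using assms
    by (simp add: sphere_measure_def emeasure_distr space_restrict_space del: Diff_iff mem_ball_0)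
qed

end

theory Submission
  imports Defs
begin

text \<open>Test the boxes with half-widths \<open>\<epsilon>\<close> in the coordinates of a set \<open>J\<close> and \<open>1\<close> in the others. Seen from
  any interior point \<open>z\<close>, each coordinate has one direction in which the box extends at least as far
  as from its centre, so the radial function is at least \<open>1\<close> on a spherical set (a piece of one
  orthant) of measure of order \<open>\<epsilon> ^ |J|\<close>. The radial function of the dual body is the inverse of the
  support function, which is at most of order \<open>\<epsilon>\<close> on a spherical set of measure of order
  \<open>\<epsilon> ^ (n + 1 - |J|)\<close>. Hence the product is at least of order
  \<open>\<epsilon> powr (|J| / \<alpha> + (n + 1 - |J|) / \<beta> - 1)\<close>; take \<open>|J| = n\<close> or \<open>|J| = 1\<close>.\<close>

section \<open>The sphere measure is finite\<close>

lemma emeasure_sphere_measure_finite: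
  "emeasure (sphere_measure :: 'a::euclidean_space measure) A < \<infinity>"
proof -
  let ?S = "sphere 0 1 :: 'a set"
  have S: "?S \<in> sets sphere_measure"
    by (metis sets.top space_sphere_measure)
  have "emeasure lborel {x \<in> ball 0 1 - {0}. x /\<^sub>R norm x \<in> ?S} \<le> emeasure lborel (ball 0 1 :: 'a set)"
    by (intro emeasure_mono) auto
  also have "\<dots> < \<infinity>"
    by (rule emeasure_bounded_finite) simp
  finally have "emeasure sphere_measure ?S < \<infinity>"
    unfolding emeasure_sphere_measure[OF S]
    by (simp add: ennreal_mult_less_top of_nat_less_top)
  moreover have "emeasure sphere_measure A \<le> emeasure sphere_measure ?S"
    by (metis emeasure_space space_sphere_measure)
  ultimately show ?thesis
    by (rule order.strict_trans1[rotated])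
qed

lemma finite_measure_sphere_measure: "finite_measure (sphere_measure :: 'a::euclidean_space measure)"
  using emeasure_sphere_measure_finite by (intro finite_measureI) (simp add: less_top)

lemma sets_sphere_measure_closed:
  assumes "closed A" "A \<subseteq> sphere 0 1"
  shows "A \<in> sets (sphere_measure :: 'a::euclidean_space measure)"
  using assms by (simp add: sets_sphere_measure sets_restrict_space_iff)

section \<open>Radial functions: bounds, measurability, integrals\<close>

lemma bdd_above_radial:
  fixes K :: "'a::euclidean_space set"
  assumes "bounded K" "norm x = 1"
  shows "bdd_above {t. t > 0 \<and> t *\<^sub>R x + z \<in> K}"
proof -
  obtain B where B: "\<And>y. y \<in> K \<Longrightarrow> norm y \<le> B"
    using assms(1) bounded_iff by blast
  show ?thesis
  proof (rule bdd_aboveI)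
    fix t assume "t \<in> {t. t > 0 \<and> t *\<^sub>R x + z \<in> K}"
    then have "t > 0" "norm (t *\<^sub>R x + z) \<le> B" using B by auto
    moreover have "norm (t *\<^sub>R x) \<le> norm (t *\<^sub>R x + z) + norm z"
      by (metis add_diff_cancel norm_triangle_ineq4)
    ultimately show "t \<le> B + norm z" using assms(2) by simp
  qed
qed

lemma le_radial_function:
  fixes K :: "'a::euclidean_space set"
  assumes "bounded K" "norm x = 1" "t > 0" "t *\<^sub>R x + z \<in> K"
  shows "t \<le> radial_function K z x"
  unfolding radial_function_def
  by (rule cSup_upper) (use assms bdd_above_radial in auto)

text \<open>A real \<open>Sup\<close> is only informative for nonempty sets that are bounded above.
  This lemma and \<open>bdd_above_radial\<close> supply the two conditions.\<close>

lemma radial_set_nonempty: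
  fixes K :: "'a::euclidean_space set"
  assumes "z \<in> interior K" "norm x = 1"
  shows "{t. t > 0 \<and> t *\<^sub>R x + z \<in> K} \<noteq> {}"
proof -
  obtain e where e: "e > 0" "cball z e \<subseteq> K"
    using assms(1) mem_interior_cball by blast
  then have "e *\<^sub>R x + z \<in> K"
    using assms(2) by (intro subsetD[OF e(2)]) (simp add: dist_norm)
  then show ?thesis using e by auto
qed

lemma radial_function_nonneg:
  fixes K :: "'a::euclidean_space set"
  assumes "bounded K" "z \<in> interior K" "norm x = 1"
  shows "0 \<le> radial_function K z x"
  using radial_set_nonempty[OF assms(2,3)] le_radial_function[OF assms(1,3)]
  by (smt (verit) Collect_empty_eq)

lemma radial_function_le:
  fixes K :: "'a::euclidean_space set"
  assumes "z \<in> interior K" "norm x = 1" "\<And>y. y \<in> K \<Longrightarrow> norm y \<le> B"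
  shows "radial_function K z x \<le> B + norm z"
  unfolding radial_function_def
proof (rule cSup_least[OF radial_set_nonempty[OF assms(1,2)]])
  fix t assume "t \<in> {t. t > 0 \<and> t *\<^sub>R x + z \<in> K}"
  then have "t > 0" "norm (t *\<^sub>R x + z) \<le> B" using assms(3) by auto
  moreover have "norm (t *\<^sub>R x) \<le> norm (t *\<^sub>R x + z) + norm z"
    by (metis add_diff_cancel norm_triangle_ineq4)
  ultimately show "t \<le> B + norm z" using assms(2) by simp
qed

text \<open>By convexity the segment from \<open>z\<close> to any point of \<open>K\<close> stays in
  \<open>K\<close>, so a real witness can be lowered to a rational one. The restriction to rationals
  makes each superlevel set a countable union, as measurability requires.\<close>

lemma less_radial_function_iff:
  fixes K :: "'a::euclidean_space set"
  assumes "compact K" "convex K" "z \<in> interior K" "norm x = 1"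
  shows "a < radial_function K z x \<longleftrightarrow> (\<exists>q\<in>{q\<in>\<rat>. 0 < q \<and> a < q}. q *\<^sub>R x + z \<in> K)"
proof
  assume "a < radial_function K z x"
  then obtain t where t: "t > 0" "t *\<^sub>R x + z \<in> K" "a < t"
    unfolding radial_function_def
    using less_cSup_iff[OF radial_set_nonempty[OF assms(3,4)]
        bdd_above_radial[OF compact_imp_bounded[OF assms(1)] assms(4)]] by auto
  obtain q where q: "q \<in> \<rat>" "max 0 a < q" "q < t"
    using Rats_dense_in_real[of "max 0 a" t] t by auto
  \<comment> \<open>Since 0 < \<open>q\<close> < \<open>t\<close>, the new point is a convex
    combination of \<open>z\<close> and the witness for \<open>t\<close>.\<close>
  have "q *\<^sub>R x + z = (1 - q / t) *\<^sub>R z + (q / t) *\<^sub>R (t *\<^sub>R x + z)"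
    using t(1) by (simp add: algebra_simps)
  also have "\<dots> \<in> K"
    using assms t q interior_subset by (intro convexD) auto
  finally show "\<exists>q\<in>{q\<in>\<rat>. 0 < q \<and> a < q}. q *\<^sub>R x + z \<in> K"
    using q by auto
next
  assume "\<exists>q\<in>{q\<in>\<rat>. 0 < q \<and> a < q}. q *\<^sub>R x + z \<in> K"
  then show "a < radial_function K z x"
    using le_radial_function[OF compact_imp_bounded[OF assms(1)] assms(4)] by force
qed

lemma borel_measurable_radial_function:
  fixes K :: "'a::euclidean_space set"
  assumes "compact K" "convex K" "z \<in> interior K"
  shows "radial_function K z \<in> borel_measurable sphere_measure"
  unfolding borel_measurable_iff_greater
proof
  fix a :: real
  let ?Q = "{q\<in>\<rat>. 0 < q \<and> a < q}"
  have "{x \<in> space sphere_measure. a < radial_function K z x}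
      = (\<Union>q\<in>?Q. {x \<in> sphere 0 1. q *\<^sub>R x + z \<in> K})"
    using less_radial_function_iff[OF assms] by (auto simp: space_sphere_measure)
  also have "\<dots> \<in> sets sphere_measure"
  proof (rule sets.countable_UN'')
    show "countable ?Q" by (rule countable_subset[OF _ countable_rat]) auto
    fix q
    have "closed ((\<lambda>x. q *\<^sub>R x + z) -` K)"
      using assms(1) compact_imp_closed
      by (intro continuous_closed_vimage) (auto intro!: continuous_intros)
    then have "closed (sphere 0 1 \<inter> (\<lambda>x. q *\<^sub>R x + z) -` K)" by auto
    then show "{x \<in> sphere 0 1. q *\<^sub>R x + z \<in> K} \<in> sets sphere_measure"
      by (intro sets_sphere_measure_closed) (auto simp: vimage_def Int_def)
  qed
  finally show "{x \<in> space sphere_measure. a < radial_function K z x} \<in> sets sphere_measure" .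
qed

text \<open>A Markov-type bound: the radial function is at least \<open>c\<close> on
  \<open>A\<close> and nonnegative elsewhere, so its power dominates a multiple of the indicator of
  \<open>A\<close>.\<close>

lemma radial_integral_ge:
  fixes K :: "'a::euclidean_space set"
  assumes K: "compact K" "convex K" "z \<in> interior K" and p: "p > 0" and c: "c > 0"
    and A: "A \<in> sets sphere_measure" and cA: "\<And>x. x \<in> A \<Longrightarrow> c *\<^sub>R x + z \<in> K"
  shows "c powr p * measure sphere_measure A \<le> (LINT x|sphere_measure. radial_function K z x powr p)"
proof -
  interpret finite_measure "sphere_measure :: 'a measure" by (rule finite_measure_sphere_measure)
  note [measurable] = borel_measurable_radial_function[OF K] A
  have b: "bounded K" by (rule compact_imp_bounded[OF K(1)])
  obtain B where B: "\<And>y. y \<in> K \<Longrightarrow> norm y \<le> B"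
    using b bounded_iff by blast
  have A': "norm x = 1" if "x \<in> A" for x
    using sets.sets_into_space[OF A] that by (auto simp: space_sphere_measure)
  \<comment> \<open>Integrability is essential: the Bochner integral of a nonintegrable function is
    0 by default, which would defeat a lower bound.\<close>
  have "integrable sphere_measure (\<lambda>x. radial_function K z x powr p)"
  proof (rule integrable_const_bound[where B = "(B + norm z) powr p"])
    show "AE x in sphere_measure. norm (radial_function K z x powr p) \<le> (B + norm z) powr p"
      using radial_function_nonneg[OF b K(3)] radial_function_le[OF K(3) _ B] p
      by (intro AE_I2) (auto simp: space_sphere_measure intro!: powr_mono2)
  qed measurable
  moreover have "integrable sphere_measure (\<lambda>x. c powr p * indicator A x)"
    by (intro integrable_mult_right integrable_real_indicator) (auto simp: emeasure_eq_measure)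
  moreover have "c powr p * indicator A x \<le> radial_function K z x powr p" for x
    using le_radial_function[OF b A' c cA] c p
    by (auto simp: indicator_def intro!: powr_mono2)
  ultimately have "(LINT x|sphere_measure. c powr p * indicator A x)
      \<le> (LINT x|sphere_measure. radial_function K z x powr p)"
    by (intro integral_mono) auto
  then show ?thesis by (simp add: Int_absorb2 sets.sets_into_space[OF A])
qed

section \<open>The dual body satisfies the hypotheses of \<open>radial_integral_ge\<close>\<close>

lemma mem_dual_body_iff: "w + z \<in> dual_body K z \<longleftrightarrow> (\<forall>x\<in>K. w \<bullet> (x - z) \<le> 1)"
  by (auto simp: dual_body_def)

text \<open>In the form of an intersection, convexity and closedness can be checked for one
  \<open>x\<close> at a time.\<close>

lemma dual_body_eq: "dual_body K z = (\<Inter>x\<in>K. {v. (v - z) \<bullet> (x - z) \<le> 1})"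
proof (intro set_eqI)
  fix v
  show "v \<in> dual_body K z \<longleftrightarrow> v \<in> (\<Inter>x\<in>K. {v. (v - z) \<bullet> (x - z) \<le> 1})"
    using mem_dual_body_iff[of "v - z" z K] by simp
qed

lemma convex_dual_body: "convex (dual_body K z)"
proof -
  have "{v. (v - z) \<bullet> (x - z) \<le> 1} = {v. (x - z) \<bullet> v \<le> 1 + (x - z) \<bullet> z}" for x
    by (auto simp: algebra_simps inner_commute)
  then show ?thesis
    unfolding dual_body_eq by (auto intro!: convex_INT convex_halfspace_le)
qed

text \<open>Polarity reverses inclusions: a ball of radius \<open>e\<close> about \<open>z\<close>
  inside \<open>K\<close> confines the dual body to the ball of radius \<open>1 / e\<close>.\<close>

lemma compact_dual_body:
  fixes K :: "'a::euclidean_space set"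
  assumes "z \<in> interior K"
  shows "compact (dual_body K z)"
proof -
  obtain e where e: "e > 0" "cball z e \<subseteq> K"
    using assms mem_interior_cball by blast
  have "closed (dual_body K z)"
    unfolding dual_body_eq by (intro closed_INT ballI closed_Collect_le continuous_intros)
  moreover have "dual_body K z \<subseteq> cball z (1 / e)"
  proof
    fix v assume v: "v \<in> dual_body K z"
    show "v \<in> cball z (1 / e)"
    proof (cases "v = z")
      case False
      \<comment> \<open>The point of the inner ball farthest in the direction of
        \<open>v - z\<close>; pairing with it gives \<open>e * norm (v - z)\<close>.\<close>
      define x where "x = z + (e / norm (v - z)) *\<^sub>R (v - z)"
      have "x \<in> K"
        using e False by (intro subsetD[OF e(2)]) (auto simp: x_def dist_norm)
      then have "(v - z) \<bullet> (x - z) \<le> 1"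
        using v unfolding dual_body_eq by auto
      then have "e * norm (v - z) \<le> 1"
        using False by (simp add: x_def dot_square_norm power2_eq_square)
      then show ?thesis
        using e by (simp add: field_simps dist_norm norm_minus_commute)
    qed (use e in auto)
  qed
  ultimately show ?thesis
    using bounded_subset bounded_cball compact_eq_bounded_closed by blast
qed

text \<open>The reverse inclusion: if \<open>K\<close> lies within distance \<open>B\<close> of
  \<open>z\<close>, Cauchy-Schwarz puts the ball of radius \<open>1 / B\<close> about
  \<open>z\<close> into the dual body.\<close>

lemma interior_dual_body:
  fixes K :: "'a::euclidean_space set"
  assumes "bounded K"
  shows "z \<in> interior (dual_body K z)"
proof -
  obtain B where B: "B > 0" "\<And>y. y \<in> K \<Longrightarrow> norm (y - z) \<le> B"
    using bounded_translation[OF assms, of "- z"] unfolding bounded_pos by auto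
  have "ball z (1 / B) \<subseteq> dual_body K z"
  proof
    fix v assume v: "v \<in> ball z (1 / B)"
    have "(v - z) \<bullet> (x - z) \<le> 1" if "x \<in> K" for x
    proof -
      have "(v - z) \<bullet> (x - z) \<le> norm (v - z) * norm (x - z)"
        by (rule norm_cauchy_schwarz)
      also have "\<dots> \<le> 1 / B * B"
        using v B that by (intro mult_mono) (auto simp: dist_norm norm_minus_commute)
      finally show ?thesis using B by simp
    qed
    then show "v \<in> dual_body K z" unfolding dual_body_eq by auto
  qed
  then show ?thesis
    using B(1) by (meson centre_in_ball divide_pos_pos interior_maximal open_ball subsetD zero_less_one)
qed

section \<open>Thin pieces of one orthant of the sphere\<close>

definition orthant_piece :: "('d::finite \<Rightarrow> real) \<Rightarrow> 'd set \<Rightarrow> real \<Rightarrow> (real ^ 'd) set" where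
  "orthant_piece s J \<epsilon> = {u \<in> sphere 0 1. (\<forall>i. 0 \<le> s i * u $ i) \<and> (\<forall>i\<in>J. \<bar>u $ i\<bar> \<le> \<epsilon>)}"

text \<open>The weak inequalities in the definition make the piece closed, hence measurable.\<close>

lemma closed_orthant_piece: "closed (orthant_piece s J \<epsilon>)"
proof -
  have "orthant_piece s J \<epsilon> =
      sphere 0 1 \<inter> (\<Inter>i. {u. 0 \<le> s i * u $ i}) \<inter> (\<Inter>i\<in>J. {u. \<bar>u $ i\<bar> \<le> \<epsilon>})"
    by (auto simp: orthant_piece_def)
  moreover have "closed \<dots>"
    by (intro closed_Int closed_sphere closed_INT ballI closed_Collect_le continuous_intros)
  ultimately show ?thesis by simp
qed

text \<open>The cone over the piece contains a box with sides of order \<open>\<epsilon>\<close> in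
  the coordinates of \<open>J\<close> and of order 1 in the others; its volume is the bound.\<close>

lemma measure_orthant_piece_ge:
  fixes s :: "'d::finite \<Rightarrow> real"
  assumes s: "\<And>i. \<bar>s i\<bar> = 1" and \<epsilon>: "0 < \<epsilon>" "\<epsilon> \<le> 1" and J: "J \<noteq> UNIV"
  shows "(1 / (2 * (real CARD('d) + 1))) ^ CARD('d) * \<epsilon> ^ card J
    \<le> measure sphere_measure (orthant_piece s J \<epsilon>)"
proof -
  let ?P = "orthant_piece s J \<epsilon>"
  let ?cone = "{x \<in> ball 0 1 - {0}. x /\<^sub>R norm x \<in> ?P}"
  \<comment> \<open>With this value the l1 norm of a point of the box is at most
    \<open>CARD('d) * \<delta>\<close> < 1, so the box lies in the unit ball.\<close>
  define \<delta> where "\<delta> = 1 / (real CARD('d) + 1)"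
  \<comment> \<open>\<open>lo\<close> and \<open>hi\<close> bound the absolute values of the
    coordinates; \<open>a\<close> and \<open>b\<close> reflect these intervals where
    \<open>s i = -1\<close>. The lower bound \<open>\<delta> / 2\<close> off \<open>J\<close> keeps
    the norm at least \<open>\<delta> / 2\<close>, so the width
    \<open>\<delta> / 2 * \<epsilon>\<close> on \<open>J\<close> survives normalisation as
    \<open>\<epsilon>\<close>.\<close>
  define lo where "lo i = (if i \<in> J then 0 else \<delta> / 2)" for i
  define hi where "hi i = (if i \<in> J then \<delta> / 2 * \<epsilon> else \<delta>)" for i
  define a where "a = (\<chi> i. if s i = 1 then lo i else - hi i)"
  define b where "b = (\<chi> i. if s i = 1 then hi i else - lo i)"
  have \<delta>: "\<delta> > 0" by (simp add: \<delta>_def add_nonneg_pos)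
  have \<delta>\<epsilon>: "\<delta> * \<epsilon> \<le> \<delta>"
    using \<delta> \<epsilon> by (simp add: mult_left_le)
  have lohi: "0 \<le> lo i" "lo i \<le> hi i" "hi i \<le> \<delta>" for i
    using \<delta> \<epsilon> \<delta>\<epsilon> by (auto simp: lo_def hi_def)
  have s': "s i = 1 \<or> s i = -1" for i using s[of i] by linarith
  have sub: "cbox a b \<subseteq> ?cone"
  proof
    fix x assume "x \<in> cbox a b"
    then have x: "lo i \<le> s i * x $ i" "s i * x $ i \<le> hi i" for i
      using s'[of i] unfolding mem_box_cart a_def b_def
      by (auto dest!: spec[of _ i])
    have absx: "\<bar>x $ i\<bar> = s i * x $ i" for i
      using x(1)[of i] lohi(1)[of i] s'[of i] by auto
    obtain k where k: "k \<notin> J" using J by auto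
    have "\<delta> / 2 \<le> \<bar>x $ k\<bar>" using x(1)[of k] k absx[of k] by (simp add: lo_def)
    also have "\<dots> \<le> norm x" by (rule component_le_norm_cart)
    finally have nx: "\<delta> / 2 \<le> norm x" .
    have x0: "norm x > 0" using nx \<delta> by linarith
    have "norm x \<le> (\<Sum>i\<in>UNIV. \<bar>x $ i\<bar>)" by (rule norm_le_l1_cart)
    also have "\<dots> \<le> (\<Sum>i\<in>(UNIV::'d set). \<delta>)"
      using x(2) lohi(3) by (intro sum_mono) (metis absx order_trans)
    also have "\<dots> < 1" by (simp add: \<delta>_def)
    finally have nx1: "norm x < 1" .
    have "\<bar>x $ i\<bar> \<le> \<epsilon> * norm x" if "i \<in> J" for i
    proof -
      have "\<bar>x $ i\<bar> \<le> \<epsilon> * (\<delta> / 2)" using x(2)[of i] that absx[of i] by (simp add: hi_def mult.commute)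
      also have "\<dots> \<le> \<epsilon> * norm x" using nx \<epsilon> by (intro mult_left_mono) auto
      finally show ?thesis .
    qed
    moreover have "0 \<le> s i * (inverse (norm x) * x $ i)" for i
    proof -
      have "0 \<le> inverse (norm x) * (s i * x $ i)"
        using order_trans[OF lohi(1) x(1)] by simp
      then show ?thesis by (simp only: mult.left_commute)
    qed
    ultimately show "x \<in> ?cone"
      using nx1 x0 by (auto simp: orthant_piece_def abs_mult divide_simps)
  qed
  have P: "?P \<in> sets sphere_measure"
    by (rule sets_sphere_measure_closed[OF closed_orthant_piece]) (auto simp: orthant_piece_def)
  \<comment> \<open>Monotonicity of \<open>emeasure\<close> needs the larger set to be measurable,
    since nonmeasurable sets get the value 0.\<close>
  have "(\<lambda>x. x /\<^sub>R norm x) \<in> borel_measurable (borel :: (real ^ 'd) measure)"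
    by measurable
  then have "(\<lambda>x. x /\<^sub>R norm x) -` ?P \<in> sets borel"
    using measurable_sets_borel closed_orthant_piece borel_closed by blast
  then have "(ball 0 1 - {0}) \<inter> (\<lambda>x. x /\<^sub>R norm x) -` ?P \<in> sets borel"
    by (intro sets.Int sets.Diff) auto
  then have cone: "?cone \<in> sets lborel"
    by (simp add: Int_def vimage_def)
  have ab: "\<And>i. a $ i \<le> b $ i" using lohi(2) by (auto simp: a_def b_def)
  have "measure lborel (cbox a b) = (\<Prod>i\<in>UNIV. b $ i - a $ i)"
    using ab by (intro content_cbox_cart) (auto simp: interval_ne_empty_cart)
  also have "\<dots> = (\<Prod>i\<in>UNIV. \<delta> / 2 * (if i \<in> J then \<epsilon> else 1))"
    by (intro prod.cong) (auto simp: a_def b_def lo_def hi_def)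
  also have "\<dots> = (\<delta> / 2) ^ CARD('d) * \<epsilon> ^ card J"
    by (simp only: prod.distrib) (simp add: prod.If_cases)
  finally have "ennreal ((\<delta> / 2) ^ CARD('d) * \<epsilon> ^ card J) = emeasure lborel (cbox a b)"
    using emeasure_lborel_cbox_finite[of a b] by (subst emeasure_eq_ennreal_measure) auto
  also have "\<dots> \<le> emeasure lborel ?cone"
    by (rule emeasure_mono[OF sub cone])
  \<comment> \<open>The dimension factor in the sphere measure is at least 1, so the cone volume is
    already a lower bound.\<close>
  also have "\<dots> \<le> of_nat DIM(real ^ 'd) * emeasure lborel ?cone"
  proof -
    have "1 \<le> (of_nat DIM(real ^ 'd) :: ennreal)"
      by (metis DIM_positive One_nat_def Suc_leI of_nat_1 of_nat_mono)
    from mult_right_mono[OF this zero_le] show ?thesis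
      by (simp only: mult_1)
  qed
  also have "\<dots> = emeasure sphere_measure ?P"
    by (rule emeasure_sphere_measure[OF P, symmetric])
  also have "\<dots> = ennreal (measure sphere_measure ?P)"
    using emeasure_sphere_measure_finite[of ?P] by (intro emeasure_eq_ennreal_measure) auto
  finally have "(\<delta> / 2) ^ CARD('d) * \<epsilon> ^ card J \<le> measure sphere_measure ?P"
    by simp
  moreover have "\<delta> / 2 = 1 / (2 * (real CARD('d) + 1))"
    by (simp add: \<delta>_def mult.commute)
  ultimately show ?thesis by simp
qed

section \<open>Lower bound for the product on thin boxes\<close>

lemma inner_le_of_box:
  fixes u y :: "real ^ 'd::finite"
  assumes "norm u = 1" "0 \<le> \<epsilon>"
    and "\<And>i. i \<in> J \<Longrightarrow> \<bar>y $ i\<bar> \<le> 2 * \<epsilon>" "\<And>i. i \<notin> J \<Longrightarrow> \<bar>y $ i\<bar> \<le> 2"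
    and "\<And>i. i \<notin> J \<Longrightarrow> \<bar>u $ i\<bar> \<le> \<epsilon>"
  shows "u \<bullet> y \<le> 2 * real CARD('d) * \<epsilon>"
proof -
  \<comment> \<open>In every coordinate one factor is small: \<open>y\<close> on \<open>J\<close>,
    \<open>u\<close> off \<open>J\<close>. The 2 is there because \<open>y\<close> will be a
    difference of two points of the box.\<close>
  have "u $ i * y $ i \<le> 2 * \<epsilon>" for i
  proof -
    have "\<bar>u $ i\<bar> \<le> 1" using component_le_norm_cart[of u i] assms(1) by simp
    then have "\<bar>u $ i\<bar> * \<bar>y $ i\<bar> \<le> 2 * \<epsilon>"
      using mult_mono[of "\<bar>u $ i\<bar>" 1 "\<bar>y $ i\<bar>" "2 * \<epsilon>"]
        mult_mono[of "\<bar>u $ i\<bar>" \<epsilon> "\<bar>y $ i\<bar>" 2] assms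
      by (cases "i \<in> J") auto
    then show ?thesis by (metis abs_le_D1 abs_mult)
  qed
  then have "(\<Sum>i\<in>UNIV. u $ i * y $ i) \<le> (\<Sum>i\<in>(UNIV::'d set). 2 * \<epsilon>)"
    by (intro sum_mono) auto
  then show ?thesis by (simp add: inner_vec_def)
qed

lemma box_mem_convex_bodies:
  fixes a :: "real ^ 'd::finite"
  assumes "\<And>i. 0 < a $ i"
  shows "cbox (- a) a \<in> convex_bodies"
proof -
  have "0 \<in> box (- a) a" using assms by (simp add: mem_box_cart)
  then show ?thesis by (auto simp: convex_bodies_def convex_box interior_cbox)
qed

text \<open>The constant \<open>c\<close> is chosen before \<open>\<epsilon>\<close> and
  \<open>z\<close>: uniformity in \<open>z\<close> handles the infimum, uniformity in
  \<open>\<epsilon>\<close> allows the box to degenerate.\<close>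

lemma box_radial_product_ge:
  fixes J :: "'d::finite set"
  assumes \<alpha>: "\<alpha> > 0" and \<beta>: "\<beta> > 0" and J: "J \<noteq> {}" "J \<noteq> UNIV"
  obtains c where "c > 0"
    and "\<And>\<epsilon> z \<Omega>. 0 < \<epsilon> \<Longrightarrow> \<epsilon> \<le> 1 \<Longrightarrow>
      \<Omega> = cbox (- (\<chi> i. if i \<in> J then \<epsilon> else 1)) (\<chi> i. if i \<in> J then \<epsilon> else 1) \<Longrightarrow> z \<in> interior \<Omega> \<Longrightarrow>
      c * \<epsilon> powr (real (card J) / \<alpha> + real (card (- J)) / \<beta> - 1) \<le>
       (LINT x|sphere_measure. radial_function \<Omega> z x powr \<alpha>) powr (1 / \<alpha>) *
       (LINT x|sphere_measure. radial_function (dual_body \<Omega> z) z x powr \<beta>) powr (1 / \<beta>)"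
proof -
  define k where "k = (1 / (2 * (real CARD('d) + 1))) ^ CARD('d)"
  define D where "D = real CARD('d)"
  have k: "k > 0" by (simp add: k_def add_nonneg_pos)
  have D: "D > 0" by (simp add: D_def)
  show thesis
  proof (rule that)
    show "k powr (1 / \<alpha>) * (1 / (2 * D) * k powr (1 / \<beta>)) > 0"
      using k D by simp
    fix \<epsilon> :: real and z :: "real ^ 'd" and \<Omega>
    assume \<epsilon>: "0 < \<epsilon>" "\<epsilon> \<le> 1"
      and \<Omega>: "\<Omega> = cbox (- (\<chi> i. if i \<in> J then \<epsilon> else 1)) (\<chi> i. if i \<in> J then \<epsilon> else 1)"
      and z: "z \<in> interior \<Omega>"
    let ?I1 = "LINT x|sphere_measure. radial_function \<Omega> z x powr \<alpha>"
    let ?I2 = "LINT x|sphere_measure. radial_function (dual_body \<Omega> z) z x powr \<beta>"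
    have mem: "x \<in> \<Omega> \<longleftrightarrow> (\<forall>i. \<bar>x $ i\<bar> \<le> (if i \<in> J then \<epsilon> else 1))" for x
      unfolding \<Omega> mem_box_cart by (auto simp: abs_le_iff minus_le_iff)
    have cpt: "compact \<Omega>" "convex \<Omega>" by (auto simp: \<Omega> convex_box)
    have z\<Omega>: "z \<in> \<Omega>" using z interior_subset by auto
    have meas: "orthant_piece s I \<epsilon> \<in> sets sphere_measure" for s :: "'d \<Rightarrow> real" and I
      by (rule sets_sphere_measure_closed[OF closed_orthant_piece]) (auto simp: orthant_piece_def)
    \<comment> \<open>In this orthant the coordinates of \<open>u\<close> and \<open>z\<close> never
      have the same strict sign, so each coordinate of \<open>u + z\<close> is at most the larger of
      the two in absolute value and stays within the box.\<close>
    define s where "s i = (if z $ i \<ge> 0 then -1 else 1 :: real)" for i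
    have s: "\<bar>s i\<bar> = 1" for i by (simp add: s_def)
    have "1 powr \<alpha> * measure sphere_measure (orthant_piece s J \<epsilon>) \<le> ?I1"
    proof (rule radial_integral_ge[OF cpt z \<alpha> _ meas])
      fix u assume u: "u \<in> orthant_piece s J \<epsilon>"
      have "\<bar>u $ i + z $ i\<bar> \<le> (if i \<in> J then \<epsilon> else 1)" for i
      proof -
        have "\<bar>u $ i\<bar> \<le> 1" using component_le_norm_cart[of u i] u by (simp add: orthant_piece_def)
        then have "\<bar>u $ i\<bar> \<le> (if i \<in> J then \<epsilon> else 1)" using u by (auto simp: orthant_piece_def)
        moreover have "\<bar>z $ i\<bar> \<le> (if i \<in> J then \<epsilon> else 1)" using z\<Omega> mem by blast
        moreover have "0 \<le> s i * u $ i" using u by (simp add: orthant_piece_def)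
        ultimately show ?thesis by (simp add: s_def split: if_splits)
      qed
      then show "1 *\<^sub>R u + z \<in> \<Omega>" unfolding mem by simp
    qed simp
    moreover have "k * \<epsilon> ^ card J \<le> measure sphere_measure (orthant_piece s J \<epsilon>)"
      unfolding k_def by (rule measure_orthant_piece_ge[OF s \<epsilon> J(2)])
    ultimately have I1: "k * \<epsilon> powr real (card J) \<le> ?I1"
      using \<epsilon> by (simp add: powr_realpow)
    \<comment> \<open>The reciprocal of the bound from \<open>inner_le_of_box\<close>, so that
      \<open>t *\<^sub>R u\<close> pairs to at most 1 with \<open>x - z\<close> for \<open>x\<close>
      in the box.\<close>
    define t where "t = 1 / (2 * D * \<epsilon>)"
    have t: "t > 0" using D \<epsilon> by (simp add: t_def)
    \<comment> \<open>The small coordinates are now those in \<open>- J\<close>, because the dual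
      body is long where the box is thin. The constant sign pattern is an arbitrary choice.\<close>
    have "t powr \<beta> * measure sphere_measure (orthant_piece (\<lambda>_. 1) (- J) \<epsilon>) \<le> ?I2"
    proof (rule radial_integral_ge[OF compact_dual_body[OF z] convex_dual_body
          interior_dual_body[OF compact_imp_bounded[OF cpt(1)]] \<beta> t meas])
      fix u :: "real ^ 'd" assume u: "u \<in> orthant_piece (\<lambda>_. 1) (- J) \<epsilon>"
      have "u \<bullet> (x - z) \<le> 2 * D * \<epsilon>" if "x \<in> \<Omega>" for x
        unfolding D_def
      proof (rule inner_le_of_box[where J = J])
        have d: "\<bar>(x - z) $ i\<bar> \<le> 2 * (if i \<in> J then \<epsilon> else 1)" for i
        proof -
          have "\<bar>x $ i\<bar> \<le> (if i \<in> J then \<epsilon> else 1)" "\<bar>z $ i\<bar> \<le> (if i \<in> J then \<epsilon> else 1)"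
            using that z\<Omega> mem by blast+
          then show ?thesis using abs_triangle_ineq4[of "x $ i" "z $ i"] by simp
        qed
        show "\<bar>(x - z) $ i\<bar> \<le> 2 * \<epsilon>" if "i \<in> J" for i using d[of i] that by simp
        show "\<bar>(x - z) $ i\<bar> \<le> 2" if "i \<notin> J" for i using d[of i] that by simp
      qed (use u \<epsilon> in \<open>auto simp: orthant_piece_def\<close>)
      then show "t *\<^sub>R u + z \<in> dual_body \<Omega> z"
        unfolding mem_dual_body_iff t_def using D \<epsilon> by simp
    qed
    moreover have "k * \<epsilon> ^ card (- J) \<le> measure sphere_measure (orthant_piece (\<lambda>_::'d. 1) (- J) \<epsilon>)"
      unfolding k_def by (rule measure_orthant_piece_ge) (use \<epsilon> J in auto)
    ultimately have I2: "t powr \<beta> * (k * \<epsilon> powr real (card (- J))) \<le> ?I2"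
      using \<epsilon> by (smt (verit, best) mult_left_mono powr_ge_zero powr_realpow)
    have "(k * \<epsilon> powr real (card J)) powr (1 / \<alpha>) * (t powr \<beta> * (k * \<epsilon> powr real (card (- J)))) powr (1 / \<beta>)
        \<le> ?I1 powr (1 / \<alpha>) * ?I2 powr (1 / \<beta>)"
      using I1 I2 k \<alpha> \<beta> by (intro mult_mono powr_mono2) auto
    moreover have "(k * \<epsilon> powr real (card J)) powr (1 / \<alpha>)
        = k powr (1 / \<alpha>) * \<epsilon> powr (real (card J) / \<alpha>)"
      using k by (simp add: powr_mult powr_powr)
    moreover have "(t powr \<beta> * (k * \<epsilon> powr real (card (- J)))) powr (1 / \<beta>)
        = t * (k powr (1 / \<beta>) * \<epsilon> powr (real (card (- J)) / \<beta>))"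
      using k t \<beta> by (simp add: powr_mult powr_powr)
    \<comment> \<open>This factor is the source of the -1 in the exponent of
      \<open>\<epsilon>\<close>.\<close>
    moreover have "t = 1 / (2 * D) * \<epsilon> powr - 1"
      using \<epsilon> by (simp add: t_def powr_minus_divide)
    moreover have "\<epsilon> powr (real (card J) / \<alpha> + real (card (- J)) / \<beta> - 1)
        = \<epsilon> powr (real (card J) / \<alpha>) * \<epsilon> powr (real (card (- J)) / \<beta>) * \<epsilon> powr - 1"
      unfolding diff_conv_add_uminus powr_add by (rule refl)
    ultimately show "k powr (1 / \<alpha>) * (1 / (2 * D) * k powr (1 / \<beta>)) *
        \<epsilon> powr (real (card J) / \<alpha> + real (card (- J)) / \<beta> - 1) \<le> ?I1 powr (1 / \<alpha>) * ?I2 powr (1 / \<beta>)"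
      by (simp add: mult_ac)
  qed
qed

section \<open>Degenerating boxes and the choice of \<open>J\<close>\<close>

lemma radial_product_unbounded:
  fixes J :: "'d::finite set"
  assumes \<alpha>: "\<alpha> > 0" and \<beta>: "\<beta> > 0" and J: "J \<noteq> {}" "J \<noteq> UNIV"
    and less: "real (card J) / \<alpha> + real (card (- J)) / \<beta> < 1"
  shows "\<not> (SUP \<Omega>\<in>(convex_bodies :: (real ^ 'd) set set). INF z\<in>interior \<Omega>.
       ereal ((LINT x|sphere_measure. radial_function \<Omega> z x powr \<alpha>) powr (1 / \<alpha>) *
              (LINT x|sphere_measure. radial_function (dual_body \<Omega> z) z x powr \<beta>) powr (1 / \<beta>)))
    \<le> ereal C"
proof
  let ?F = "\<lambda>\<Omega> z. (LINT x|sphere_measure. radial_function \<Omega> z x powr \<alpha>) powr (1 / \<alpha>) *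
      (LINT x|sphere_measure. radial_function (dual_body \<Omega> z) z x powr \<beta>) powr (1 / \<beta>)"
  assume sup: "(SUP \<Omega>\<in>(convex_bodies :: (real ^ 'd) set set). INF z\<in>interior \<Omega>. ereal (?F \<Omega> z)) \<le> ereal C"
  define p where "p = 1 - (real (card J) / \<alpha> + real (card (- J)) / \<beta>)"
  have p: "p > 0" using less by (simp add: p_def)
  obtain c where c: "c > 0"
    and ge: "\<And>\<epsilon> z \<Omega>. 0 < \<epsilon> \<Longrightarrow> \<epsilon> \<le> 1 \<Longrightarrow>
      \<Omega> = cbox (- (\<chi> i. if i \<in> J then \<epsilon> else 1)) (\<chi> i. if i \<in> J then \<epsilon> else 1) \<Longrightarrow> z \<in> interior \<Omega> \<Longrightarrow>
      c * \<epsilon> powr (real (card J) / \<alpha> + real (card (- J)) / \<beta> - 1) \<le> ?F \<Omega> z"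
    using box_radial_product_ge[OF \<alpha> \<beta> J] by blast
  \<comment> \<open>\<open>\<epsilon>\<close> solves \<open>\<epsilon> powr (- p) = M\<close>. The
    maximum with 1 forces \<open>\<epsilon>\<close> \<le> 1, and the other term makes
    \<open>c * M\<close> exceed \<open>C\<close>.\<close>
  define M where "M = max 1 (\<bar>C\<bar> / c + 1)"
  define \<epsilon> where "\<epsilon> = M powr (- (1 / p))"
  have M: "M \<ge> 1" "\<bar>C\<bar> / c < M" by (auto simp: M_def)
  have \<epsilon>: "0 < \<epsilon>" "\<epsilon> \<le> 1"
    using M p by (auto simp: \<epsilon>_def powr_minus_divide ge_one_powr_ge_zero)
  have "\<epsilon> powr (- p) = M" using M p by (simp add: \<epsilon>_def powr_powr)
  then have C: "C < c * \<epsilon> powr (real (card J) / \<alpha> + real (card (- J)) / \<beta> - 1)"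
    using M(2) c by (simp add: p_def divide_simps mult.commute abs_less_iff)
  define \<Omega> :: "(real ^ 'd) set"
    where "\<Omega> = cbox (- (\<chi> i. if i \<in> J then \<epsilon> else 1)) (\<chi> i. if i \<in> J then \<epsilon> else 1)"
  \<comment> \<open>The bound is free of \<open>z\<close>, so it passes to the infimum; this single
    box then bounds the supremum from below.\<close>
  have "ereal (c * \<epsilon> powr (real (card J) / \<alpha> + real (card (- J)) / \<beta> - 1)) \<le> (INF z\<in>interior \<Omega>. ereal (?F \<Omega> z))"
    by (rule INF_greatest) (simp only: ereal_less_eq, rule ge[OF \<epsilon> \<Omega>_def])
  also have "\<dots> \<le> (SUP \<Omega>\<in>(convex_bodies :: (real ^ 'd) set set). INF z\<in>interior \<Omega>. ereal (?F \<Omega> z))"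
    by (rule SUP_upper) (use \<epsilon> in \<open>auto simp: \<Omega>_def intro!: box_mem_convex_bodies\<close>)
  also note sup
  finally show False using C by simp
qed

theorem mainTheorem2:
  fixes n :: nat and \<alpha> \<beta> :: real
  assumes "n \<ge> 1"
    and "CARD('d::finite) = n + 1"
    and "\<alpha> > 0" and "\<beta> > 0"
    and "\<not> (real n / \<alpha> + 1 / \<beta> \<ge> 1 \<and> 1 / \<alpha> + real n / \<beta> \<ge> 1)"
  shows "\<not> (\<exists>C::real.
    (SUP \<Omega>\<in>(convex_bodies :: (real ^ 'd) set set). INF z\<in>interior \<Omega>.
       ereal ((LINT x|sphere_measure. radial_function \<Omega> z x powr \<alpha>) powr (1 / \<alpha>) *
              (LINT x|sphere_measure. radial_function (dual_body \<Omega> z) z x powr \<beta>) powr (1 / \<beta>)))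
    \<le> ereal C)"
proof -
  fix i :: 'd
  have "card (UNIV - {i}) = n"
    using assms(2) by (subst card_Diff_singleton) simp_all
  then have card: "card (- {i}) = n" "card {i} = 1"
    by (simp_all only: Compl_eq_Diff_UNIV card.insert_remove card.empty) simp
  have ne: "- {i} \<noteq> {}" "{i} \<noteq> UNIV"
    using card assms(1,2) by auto
  \<comment> \<open>The failing inequality selects the box: \<open>n\<close> thin directions
    (\<open>J = - {i}\<close>) in the first case, one (\<open>J = {i}\<close>) in the
    second.\<close>
  consider "real n / \<alpha> + 1 / \<beta> < 1" | "1 / \<alpha> + real n / \<beta> < 1"
    using assms(5) by linarith
  then show ?thesis
  proof cases
    case 1
    then show ?thesis
      using radial_product_unbounded[OF assms(3,4), of "- {i}"] ne card by auto
  next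
    case 2
    then show ?thesis
      using radial_product_unbounded[OF assms(3,4), of "{i}"] ne card by auto
  qed
qed

end
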